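(* For a Banach space $X$, the following are equivalent: (1) $X$ is infinite dimensional. (2) For any $\lambda>0$, $\mathrm{FBL}^{(\infty)}[X]$ fails the $\lambda$-Fatou property. (3) For some $\lambda>0$, $\mathrm{FBL}^{(\infty)}[X]$ fails the $\lambda$-Fatou property.
   Context: All Banach spaces are real. For a Banach space $X$, equip the space of positively homogeneous functions $X^*\to\mathbb R$ that are weak$^*$-continuous on bounded sets with pointwise order and with the norm $\|f\|_\infty=\sup\{|f(x^* )|:x^*\in X^*,\ \|x^*\|\le1\}$. For $x\in X$, $\delta_x(x^* )=\langle x^*,x\rangle$. $\mathrm{FBL}^{(\infty)}[X]$ is the $\|\cdot\|_\infty$-closure of the vector sublattice generated by $\{\delta_x:x\in X\}$. (It is known that it coincides with the whole space of positively homogeneous functions on $X^*$ that are weak$^*$-continuous on bounded sets.) A Banach lattice $Z$ has the $\lambda$-Fatou property if for every upward directed set $\mathcal S\subset Z_+$ having a supremum $z_0$ in $Z$, one has $\|z_0\|\le\lambda\sup_{z\in\mathcal S}\|z\|$.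
   Formalization: In (3), "for some λ>0" is replaced by "for some λ≥1": every nonzero Banach lattice fails the λ-Fatou property for λ<1 (take a one-element set), so as written (3) would hold for X=ℝ, which is finite dimensional. *)

theory Defs
  imports "HOL-Analysis.Analysis" "HOL-Library.Lub_Glb"
begin

(* For real-valued operators the library's strong operator topology, the coarsest one for which
   every evaluation at a point of the domain is continuous, is the weak-star topology of the dual. *)
abbreviation weak_star_topology :: "('a::real_normed_vector \<Rightarrow>\<^sub>L real) topology"
  where "weak_star_topology \<equiv> strong_operator_topology"

definition pos_homogeneous :: "('v::real_vector \<Rightarrow> real) \<Rightarrow> bool"
  where "pos_homogeneous f \<longleftrightarrow> (\<forall>t\<ge>0. \<forall>v. f (t *\<^sub>R v) = t * f v)"

definition weak_star_cont_on_bounded :: "(('a::real_normed_vector \<Rightarrow>\<^sub>L real) \<Rightarrow> real) \<Rightarrow> bool"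
  where "weak_star_cont_on_bounded f \<longleftrightarrow>
    (\<forall>B. bounded B \<longrightarrow> continuous_map (subtopology weak_star_topology B) euclideanreal f)"

definition homog_weak_star :: "(('a::real_normed_vector \<Rightarrow>\<^sub>L real) \<Rightarrow> real) set"
  where "homog_weak_star = {f. pos_homogeneous f \<and> weak_star_cont_on_bounded f}"

(* On homog_weak_star this is a supremum of a bounded set, since the dual ball is weak-star
   compact by Banach-Alaoglu; outside of it the value may be meaningless. *)
definition dual_sup_norm :: "(('a::real_normed_vector \<Rightarrow>\<^sub>L real) \<Rightarrow> real) \<Rightarrow> real"
  where "dual_sup_norm f = (SUP xs\<in>{xs. norm xs \<le> 1}. \<bar>f xs\<bar>)"

definition delta :: "'a::real_normed_vector \<Rightarrow> ('a \<Rightarrow>\<^sub>L real) \<Rightarrow> real"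
  where "delta x xs = blinfun_apply xs x"

definition vector_sublattice :: "('b \<Rightarrow> real) set \<Rightarrow> bool"
  where "vector_sublattice L \<longleftrightarrow>
    (\<lambda>_. 0) \<in> L \<and>
    (\<forall>f\<in>L. \<forall>g\<in>L. (\<lambda>b. f b + g b) \<in> L) \<and>
    (\<forall>c. \<forall>f\<in>L. (\<lambda>b. c * f b) \<in> L) \<and>
    (\<forall>f\<in>L. \<forall>g\<in>L. (\<lambda>b. max (f b) (g b)) \<in> L) \<and>
    (\<forall>f\<in>L. \<forall>g\<in>L. (\<lambda>b. min (f b) (g b)) \<in> L)"

definition FBL_infty :: "(('a::banach \<Rightarrow>\<^sub>L real) \<Rightarrow> real) set"
  where "FBL_infty = {f \<in> homog_weak_star.
    \<forall>e>0. \<exists>g \<in> vector_sublattice hull (range delta). dual_sup_norm (\<lambda>xs. f xs - g xs) < e}"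

definition upward_directed :: "'z::order set \<Rightarrow> bool"
  where "upward_directed S \<longleftrightarrow> S \<noteq> {} \<and> (\<forall>x\<in>S. \<forall>y\<in>S. \<exists>z\<in>S. x \<le> z \<and> y \<le> z)"

(* Z is a lattice of functions with the pointwise order and N its norm. The supremum is
   the least upper bound among the elements of Z; it need not be the pointwise supremum. *)
definition lambda_Fatou :: "real \<Rightarrow> ('b \<Rightarrow> real) set \<Rightarrow> (('b \<Rightarrow> real) \<Rightarrow> real) \<Rightarrow> bool"
  where "lambda_Fatou lam Z N \<longleftrightarrow>
    (\<forall>S z0. S \<subseteq> {z\<in>Z. (\<lambda>_. 0) \<le> z} \<and> upward_directed S \<and> isLub Z S z0
       \<longrightarrow> N z0 \<le> lam * (SUP z\<in>S. N z))"

definition infinite_dimensional :: "'a::real_vector itself \<Rightarrow> bool"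
  where "infinite_dimensional _ \<longleftrightarrow> \<not> (\<exists>B::'a set. finite B \<and> span B = UNIV)"

(* A singleton violates the inequality when lam < 1, so the property is meaningful only for
   lam at least 1: below that bound it fails even over the one-dimensional space. *)
lemma not_lambda_Fatou_less_1:
  assumes "lam < 1" "f \<in> Z" "(\<lambda>_. 0) \<le> f" "N f > 0"
  shows "\<not> lambda_Fatou lam Z N"
proof
  assume *: "lambda_Fatou lam Z N"
  have "isLub Z {f} f"
    using assms by (auto simp: isLub_def leastP_def isUb_def setle_def setge_def)
  then have "N f \<le> lam * (SUP z\<in>{f}. N z)"
    using * assms unfolding lambda_Fatou_def upward_directed_def by blast
  moreover have "lam * N f < 1 * N f"
    using assms by (intro mult_strict_right_mono) auto
  ultimately show False by simp
qed

lemma FBL_infty_real_not_lambda_Fatou_less_1: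
  assumes "lam < 1"
  shows "\<not> lambda_Fatou lam (FBL_infty :: ((real \<Rightarrow>\<^sub>L real) \<Rightarrow> real) set) dual_sup_norm"
proof -
  define f :: "(real \<Rightarrow>\<^sub>L real) \<Rightarrow> real" where "f = (\<lambda>xs. \<bar>delta 1 xs\<bar>)"
  have "continuous_map weak_star_topology euclideanreal f"
    unfolding f_def delta_def
    using strong_operator_topology_continuous_evaluation by (rule continuous_map_real_abs)
  then have H: "f \<in> homog_weak_star"
    by (auto simp: homog_weak_star_def pos_homogeneous_def weak_star_cont_on_bounded_def f_def
        delta_def scaleR_blinfun.rep_eq abs_mult intro: continuous_map_from_subtopology)
  have "f \<in> L" if L: "vector_sublattice L" "range delta \<subseteq> L" for L
  proof -
    have scale: "(\<lambda>xs. c * g xs) \<in> L" if "g \<in> L" for c g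
      using L(1) that by (simp add: vector_sublattice_def)
    have max: "(\<lambda>xs. max (g xs) (h xs)) \<in> L" if "g \<in> L" "h \<in> L" for g h
      using L(1) that by (simp add: vector_sublattice_def)
    have d: "delta 1 \<in> L" using L(2) by auto
    have "f = (\<lambda>xs. max (delta 1 xs) ((-1) * delta 1 xs))"
      by (auto simp: f_def)
    then show ?thesis using max[OF d scale[OF d, of "-1"]] by simp
  qed
  then have "f \<in> vector_sublattice hull (range delta)"
    by (simp add: hull_def)
  moreover have "dual_sup_norm (\<lambda>xs. f xs - f xs) = 0"
  proof -
    have "{xs :: real \<Rightarrow>\<^sub>L real. norm xs \<le> 1} \<noteq> {}"
      by (auto intro: exI[of _ 0])
    then show ?thesis by (simp add: dual_sup_norm_def)
  qed
  ultimately have F: "f \<in> FBL_infty"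
    using H unfolding FBL_infty_def by force
  have "bdd_above ((\<lambda>xs. \<bar>f xs\<bar>) ` {xs. norm xs \<le> 1})"
  proof (rule bdd_aboveI2)
    fix xs :: "real \<Rightarrow>\<^sub>L real" assume "xs \<in> {xs. norm xs \<le> 1}"
    then show "\<bar>f xs\<bar> \<le> 1" using norm_blinfun[of xs 1] by (simp add: f_def delta_def)
  qed
  then have "\<bar>f id_blinfun\<bar> \<le> dual_sup_norm f"
    unfolding dual_sup_norm_def
    by (rule cSUP_upper[rotated]) (simp add: norm_blinfun_id_le)
  then have "dual_sup_norm f > 0" by (simp add: f_def delta_def)
  then show ?thesis
    using not_lambda_Fatou_less_1[OF assms F] by (simp add: f_def le_fun_def)
qed

end

(* In finite dimension the dual norm belongs to FBL_infty, being a uniform limit of maxima over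
   finite nets of the unit ball, so M times it is an upper bound of every S whose members have norm
   at most M; hence the supremum has norm at most M and even the 1-Fatou property holds.

   In infinite dimension take z0 = |delta x| and the minorants f of z0 with 0 <= f <= e |.|, whose
   norms are at most e. Their supremum is still z0: by homogeneity an upper bound h with h < z0
   somewhere has h < z0 at a functional of small norm, and since weak-star neighbourhoods contain
   affine subspaces of finite codimension, also at a unit functional y with |y(x)| < e/2. Choosing
   v with |v| <= 1 and |y(v)| > 1/2, the minorant min(|delta x|, e |delta v|) agrees with z0 at y,
   a contradiction. Enough functionals exist by the Hahn-Banach theorem, obtained here from a
   minimal sublinear functional, which is automatically linear. *)

theory Submission
  imports Defs
begin

subsection \<open>The Hahn--Banach theorem for sublinear functionals\<close>

text \<open>Scaling is stated as an inequality for t > 0 because this form passes directly to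
  infima; equality for all t \<ge> 0 is recovered in \<open>sublinear_scale\<close>.\<close>

definition sublinear :: "('a::real_vector \<Rightarrow> real) \<Rightarrow> bool"
  where "sublinear p \<longleftrightarrow>
    p 0 = 0 \<and> (\<forall>x y. p (x + y) \<le> p x + p y) \<and> (\<forall>t>0. \<forall>x. p (t *\<^sub>R x) \<le> t * p x)"

lemma sublinear_add: "sublinear p \<Longrightarrow> p (x + y) \<le> p x + p y"
  by (simp add: sublinear_def)

lemma sublinear_scale_le: "sublinear p \<Longrightarrow> 0 < t \<Longrightarrow> p (t *\<^sub>R x) \<le> t * p x"
  by (simp add: sublinear_def)

lemma sublinear_0: "sublinear p \<Longrightarrow> p 0 = 0"
  by (simp add: sublinear_def)

text \<open>The reverse inequality is the scaling rule for \<open>inverse t\<close>, applied at the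
  already scaled vector.\<close>

lemma sublinear_scale:
  assumes "sublinear p" "0 \<le> t"
  shows "p (t *\<^sub>R x) = t * p x"
proof (cases "t = 0")
  case False
  then have t: "0 < t" using assms by simp
  have "t * p x = t * p (inverse t *\<^sub>R (t *\<^sub>R x))" using t by simp
  also have "\<dots> \<le> t * (inverse t * p (t *\<^sub>R x))"
    using sublinear_scale_le[OF assms(1), of "inverse t" "t *\<^sub>R x"] t
    by (intro mult_left_mono) auto
  also have "\<dots> = p (t *\<^sub>R x)" using t by simp
  finally show ?thesis using sublinear_scale_le[OF assms(1) t, of x] by simp
qed (simp add: sublinear_0[OF assms(1)])

lemma sublinear_minus_ge: "sublinear p \<Longrightarrow> - p (- x) \<le> p x"
  using sublinear_add[of p x "- x"] sublinear_0[of p] by simp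

text \<open>Supplies the lower bounds of chains for Zorn's lemma. All members satisfy q(x) \<ge>
  -q(-x) \<ge> -p(-x), so the infima are finite; subadditivity survives because any two members of a
  chain lie above a common member.\<close>

lemma sublinear_INF_chain:
  assumes "C \<noteq> {}"
    and sub: "\<And>q. q \<in> C \<Longrightarrow> sublinear q"
    and chain: "\<And>q q'. q \<in> C \<Longrightarrow> q' \<in> C \<Longrightarrow> q \<le> q' \<or> q' \<le> q"
    and le: "\<And>q. q \<in> C \<Longrightarrow> q \<le> p"
  shows "sublinear (\<lambda>x. INF q\<in>C. q x)"
    and "\<And>q. q \<in> C \<Longrightarrow> (\<lambda>x. INF q\<in>C. q x) \<le> q"
proof -
  have bdd: "bdd_below ((\<lambda>q. q x) ` C)" for x
  proof (rule bdd_belowI2)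
    fix q assume "q \<in> C"
    then show "- p (- x) \<le> q x"
      using sublinear_minus_ge[OF sub, of q x] le_funD[OF le, of q "- x"] by simp
  qed
  have low: "(INF q\<in>C. q x) \<le> q x" if "q \<in> C" for q x
    using bdd that by (rule cINF_lower)
  then show "(\<lambda>x. INF q\<in>C. q x) \<le> q" if "q \<in> C" for q
    using that by (simp add: le_fun_def)
  have add: "(INF q\<in>C. q (x + y)) \<le> (INF q\<in>C. q x) + (INF q\<in>C. q y)" for x y
  proof -
    have *: "(INF q\<in>C. q (x + y)) \<le> q1 x + q2 y" if q: "q1 \<in> C" "q2 \<in> C" for q1 q2
    proof -
      obtain q where "q \<in> C" "q \<le> q1" "q \<le> q2" using chain[OF q] q by blast
      then show ?thesis
        using low[of q "x + y"] sublinear_add[OF sub, of q x y]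
        by (force simp: le_fun_def intro: order_trans add_mono)
    qed
    \<comment> \<open>The two infima are taken one after the other, each time with the other term
      moved to the left-hand side.\<close>
    have "(INF q\<in>C. q (x + y)) - q1 x \<le> (INF q\<in>C. q y)" if "q1 \<in> C" for q1
      using *[OF that] by (intro cINF_greatest[OF assms(1)]) (simp add: diff_le_eq add.commute)
    then have "(INF q\<in>C. q (x + y)) - (INF q\<in>C. q y) \<le> (INF q\<in>C. q x)"
      by (intro cINF_greatest[OF assms(1)]) (simp add: algebra_simps)
    then show ?thesis by simp
  qed
  have scale: "(INF q\<in>C. q (t *\<^sub>R x)) \<le> t * (INF q\<in>C. q x)" if "0 < t" for t x
  proof -
    have "(INF q\<in>C. q (t *\<^sub>R x)) / t \<le> (INF q\<in>C. q x)"
    proof (rule cINF_greatest[OF assms(1)])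
      fix q assume "q \<in> C"
      then show "(INF q\<in>C. q (t *\<^sub>R x)) / t \<le> q x"
        using low[of q "t *\<^sub>R x"] sublinear_scale_le[OF sub, of q t x] that
        by (simp add: divide_le_eq mult.commute)
    qed
    then show ?thesis using that by (simp add: divide_le_eq mult.commute)
  qed
  have "(INF q\<in>C. q 0) = 0"
  proof -
    have "(\<lambda>q. q 0) ` C = {0}" using assms(1) sublinear_0[OF sub] by (auto simp: image_iff)
    then show ?thesis by simp
  qed
  then show "sublinear (\<lambda>x. INF q\<in>C. q x)"
    using add scale by (simp add: sublinear_def)
qed

text \<open>Lowers q towards linearity in the direction y. The value t = 0 gives r \<le> q, and t =
  1 gives the last bound, which at x = -y reads r(-y) \<le> -q(y). The infimum is finite since each
  of its terms is at least -q(-x).\<close>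

lemma sublinear_shift:
  fixes q :: "'a::real_vector \<Rightarrow> real" and y :: 'a
  assumes q: "sublinear q"
  defines "r \<equiv> \<lambda>x. INF t\<in>{0..}. q (x + t *\<^sub>R y) - t * q y"
  shows "sublinear r" and "r \<le> q" and "r x \<le> q (x + y) - q y"
proof -
  have ne: "{0::real..} \<noteq> {}" by auto
  have bdd: "bdd_below ((\<lambda>t. q (x + t *\<^sub>R y) - t * q y) ` {0..})" for x
  proof (rule bdd_belowI2)
    fix t :: real assume "t \<in> {0..}"
    then show "- q (- x) \<le> q (x + t *\<^sub>R y) - t * q y"
      using sublinear_add[OF q, of "x + t *\<^sub>R y" "- x"] sublinear_scale[OF q, of t y] by simp
  qed
  have low: "r x \<le> q (x + t *\<^sub>R y) - t * q y" if "0 \<le> t" for t x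
    unfolding r_def using bdd by (rule cINF_lower) (use that in simp)
  show "r \<le> q" using low[of 0] by (simp add: le_fun_def)
  show "r x \<le> q (x + y) - q y" using low[of 1] by simp
  have add: "r (x1 + x2) \<le> r x1 + r x2" for x1 x2
  proof -
    \<comment> \<open>Parameters s and t for the two summands combine to the parameter s + t for the
      sum.\<close>
    have "r (x1 + x2) \<le> (q (x1 + s *\<^sub>R y) - s * q y) + (q (x2 + t *\<^sub>R y) - t * q y)"
      if "0 \<le> s" "0 \<le> t" for s t
      using low[of "s + t" "x1 + x2"] that sublinear_add[OF q, of "x1 + s *\<^sub>R y" "x2 + t *\<^sub>R y"]
      by (simp add: algebra_simps)
    then have "r (x1 + x2) - (q (x1 + s *\<^sub>R y) - s * q y) \<le> r x2" if "0 \<le> s" for s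
      unfolding r_def using that by (intro cINF_greatest[OF ne]) (force simp: algebra_simps r_def)
    then have "r (x1 + x2) - r x2 \<le> r x1"
      by (subst (3) r_def, intro cINF_greatest[OF ne]) (force simp: algebra_simps)
    then show ?thesis by simp
  qed
  have scale: "r (c *\<^sub>R x) \<le> c * r x" if "0 < c" for c x
  proof -
    have "r (c *\<^sub>R x) \<le> c * (q (x + t *\<^sub>R y) - t * q y)" if "0 \<le> t" for t
      using low[of "c * t" "c *\<^sub>R x"] that \<open>0 < c\<close>
        sublinear_scale_le[OF q \<open>0 < c\<close>, of "x + t *\<^sub>R y"]
      by (simp add: algebra_simps)
    then have "r (c *\<^sub>R x) / c \<le> q (x + t *\<^sub>R y) - t * q y" if "0 \<le> t" for t
      using that \<open>0 < c\<close> by (simp add: pos_divide_le_eq mult.commute)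
    then have "r (c *\<^sub>R x) / c \<le> r x"
      by (subst (2) r_def, intro cINF_greatest[OF ne]) auto
    then show ?thesis using that by (simp add: divide_le_eq mult.commute)
  qed
  have "(\<lambda>t. q (0 + t *\<^sub>R y) - t * q y) ` {0..} = {0}"
    using sublinear_scale[OF q] by auto
  then have "r 0 = 0" by (simp add: r_def)
  then show "sublinear r" using add scale by (simp add: sublinear_def)
qed

text \<open>By minimality the shifted functional of \<open>sublinear_shift\<close> equals q, so its
  last bound becomes q(x) + q(y) \<le> q(x + y), the converse of subadditivity.\<close>

lemma minimal_sublinear_linear:
  fixes q :: "'a::real_vector \<Rightarrow> real"
  assumes q: "sublinear q" and min: "\<And>r. sublinear r \<Longrightarrow> r \<le> q \<Longrightarrow> r = q"
  shows "linear q"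
proof -
  have add: "q (x + y) = q x + q y" for x y
  proof -
    have eq: "(\<lambda>x. INF t\<in>{0..}. q (x + t *\<^sub>R y) - t * q y) = q"
      by (rule min[OF sublinear_shift(1,2)[OF q, of y]])
    have "q x \<le> q (x + y) - q y"
      using sublinear_shift(3)[OF q, where y = y and x = x] fun_cong[OF eq, of x] by simp
    then show ?thesis using sublinear_add[OF q, of x y] by simp
  qed
  have minus: "q (- x) = - q x" for x
    using add[of x "- x"] sublinear_0[OF q] by simp
  have "q (c *\<^sub>R x) = c *\<^sub>R q x" for c x
  proof (cases "0 \<le> c")
    case False
    then show ?thesis using sublinear_scale[OF q, of "- c" x] minus[of "c *\<^sub>R x"] by simp
  qed (simp add: sublinear_scale[OF q])
  with add show ?thesis by (rule linearI)
qed

lemma ex_linear_le_sublinear: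
  fixes p :: "'a::real_vector \<Rightarrow> real"
  assumes "sublinear p"
  shows "\<exists>u. linear u \<and> u \<le> p"
proof -
  define A where "A = {q. sublinear q \<and> q \<le> p}"
  \<comment> \<open>Zorn's lemma is applied to the reversed pointwise order, so its maximal element
    is a minimal sublinear minorant of p.\<close>
  have "\<exists>m\<in>A. \<forall>a\<in>A. a \<le> m \<longrightarrow> a = m"
  proof (rule predicate_Zorn)
    show "partial_order_on A (relation_of (\<lambda>x y. y \<le> x) A)"
      by (rule partial_order_on_relation_ofI) auto
  next
    fix C assume C: "C \<in> Chains (relation_of (\<lambda>x y. y \<le> x) A)"
    show "\<exists>u\<in>A. \<forall>a\<in>C. u \<le> a"
    proof (cases "C = {}")
      \<comment> \<open>An infimum over the empty chain would be an unspecified value; here p itself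
        is the bound.\<close>
      case True
      then show ?thesis using assms by (auto simp: A_def)
    next
      case False
      have "sublinear q" "q \<le> p" if "q \<in> C" for q
        using C that by (auto simp: Chains_def relation_of_def A_def)
      moreover have "q \<le> q' \<or> q' \<le> q" if "q \<in> C" "q' \<in> C" for q q'
        using C that by (auto simp: Chains_def relation_of_def)
      ultimately have *: "sublinear (\<lambda>x. INF q\<in>C. q x)" "\<And>q. q \<in> C \<Longrightarrow> (\<lambda>x. INF q\<in>C. q x) \<le> q"
          "\<And>q. q \<in> C \<Longrightarrow> q \<le> p"
        using sublinear_INF_chain[OF False] by blast+
      then have "(\<lambda>x. INF q\<in>C. q x) \<le> p" using False by (meson equals0I order_trans)
      with * show ?thesis unfolding A_def by blast
    qed
  qed
  then obtain m where m: "m \<in> A" "\<And>a. a \<in> A \<Longrightarrow> a \<le> m \<Longrightarrow> a = m" by blast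
  then have "linear m"
    by (intro minimal_sublinear_linear) (auto simp: A_def intro: order_trans)
  with m show ?thesis by (auto simp: A_def)
qed

text \<open>Shifting p in the direction v forces r(-v) \<le> -p(v), so every linear minorant u of r
  satisfies u(v) \<ge> p(v) and hence attains p at v.\<close>

lemma Hahn_Banach_sublinear:
  fixes p :: "'a::real_vector \<Rightarrow> real"
  assumes p: "sublinear p"
  obtains u where "linear u" "u \<le> p" "u v = p v"
proof -
  define r where "r = (\<lambda>x. INF t\<in>{0..}. p (x + t *\<^sub>R v) - t * p v)"
  have r: "sublinear r" "r \<le> p" "r (- v) \<le> p (- v + v) - p v"
    unfolding r_def by (rule sublinear_shift[OF p])+
  obtain u where u: "linear u" "u \<le> r" using ex_linear_le_sublinear[OF r(1)] by blast
  have "u \<le> p" using u r by (meson order_trans)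
  moreover have "p v \<le> u v"
    using r(3) le_funD[OF u(2), of "- v"] linear_neg[OF u(1), of v] sublinear_0[OF p] by simp
  ultimately show thesis using u that by (simp add: le_fun_def antisym)
qed

section \<open>Quotient seminorms and separation from a closed subspace\<close>

lemma sublinear_infdist:
  fixes F :: "'a::real_normed_vector set"
  assumes F: "subspace F"
  shows "sublinear (\<lambda>x. infdist x F)"
proof -
  have ne: "F \<noteq> {}" using subspace_0[OF F] by blast
  \<comment> \<open>The distance need not be attained, so points of F that nearly attain it are
    used.\<close>
  have attained: "\<exists>a\<in>F. dist x a < infdist x F + e" if "0 < e" for x e
  proof (rule ccontr)
    assume "\<not> ?thesis"
    then have "infdist x F + e \<le> infdist x F"
      using ne by (subst (2) infdist_notempty) (auto intro!: cINF_greatest simp: not_less)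
    with that show False by simp
  qed
  have "infdist (x + y) F \<le> infdist x F + infdist y F" for x y
  proof (rule field_le_epsilon)
    fix e :: real assume "0 < e"
    then obtain a b where ab: "a \<in> F" "dist x a < infdist x F + e/2"
        "b \<in> F" "dist y b < infdist y F + e/2"
      using attained[of "e/2"] by (meson half_gt_zero)
    have "infdist (x + y) F \<le> dist (x + y) (a + b)"
      using subspace_add[OF F ab(1,3)] by (rule infdist_le)
    then show "infdist (x + y) F \<le> infdist x F + infdist y F + e"
      using dist_triangle_add[of x y a b] ab(2,4) by linarith
  qed
  moreover have "infdist (t *\<^sub>R x) F \<le> t * infdist x F" if "0 < t" for t x
  proof (rule field_le_epsilon)
    fix e :: real assume "0 < e"
    then obtain a where a: "a \<in> F" "dist x a < infdist x F + e/t"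
      using attained[of "e/t" x] \<open>0 < t\<close> by (meson divide_pos_pos)
    have "infdist (t *\<^sub>R x) F \<le> dist (t *\<^sub>R x) (t *\<^sub>R a)"
      using subspace_scale[OF F a(1)] by (rule infdist_le)
    also have "\<dots> = t * dist x a"
      using that by (simp add: dist_norm flip: scaleR_diff_right)
    also have "\<dots> \<le> t * (infdist x F + e/t)" using a that by (intro mult_left_mono) auto
    finally show "infdist (t *\<^sub>R x) F \<le> t * infdist x F + e" using that by (simp add: distrib_left)
  qed
  ultimately show ?thesis using subspace_0[OF F] by (simp add: sublinear_def)
qed

text \<open>Hahn-Banach is applied to the distance from F. The resulting bound by
  \<open>infdist x F\<close> makes u vanish on F and makes it bounded, and u(v) is the distance of v
  from F, which is nonzero because F is closed.\<close>

lemma separating_functional: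
  fixes F :: "'a::real_normed_vector set"
  assumes F: "subspace F" "closed F" and v: "v \<notin> F"
  obtains u :: "'a \<Rightarrow>\<^sub>L real" where "\<And>x. x \<in> F \<Longrightarrow> blinfun_apply u x = 0" "blinfun_apply u v \<noteq> 0"
proof -
  obtain u where u: "linear u" "u \<le> (\<lambda>x. infdist x F)" "u v = infdist v F"
    using Hahn_Banach_sublinear[OF sublinear_infdist[OF F(1)], of v] by blast
  have abs: "\<bar>u x\<bar> \<le> infdist x F" for x
  proof -
    \<comment> \<open>Symmetry of F makes the distance an even function, which turns the one-sided
      bound on u into a two-sided one.\<close>
    have "uminus ` F = F" using F(1) subspace_neg by force
    then have "(INF a\<in>F. dist (- x) a) = (INF a\<in>uminus ` F. dist (- x) a)" by simp
    also have "\<dots> = (INF a\<in>F. dist x a)"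
      by (simp add: image_image dist_norm norm_minus_commute)
    finally have "infdist (- x) F = infdist x F" by (simp add: infdist_def)
    then show ?thesis
      using le_funD[OF u(2), of x] le_funD[OF u(2), of "- x"] linear_neg[OF u(1), of x] by simp
  qed
  have "infdist x F \<le> norm x" for x
    using infdist_le[OF subspace_0[OF F(1)], of x] by simp
  then have "\<bar>u x\<bar> \<le> norm x * 1" for x using abs[of x] by (simp add: order_trans)
  then have bl: "bounded_linear u"
    using u(1) by (intro bounded_linear_intro[of u 1]) (auto simp: linear_add linear_scale)
  have "infdist v F \<noteq> 0" using in_closed_iff_infdist_zero[OF F(2), of v] v subspace_0[OF F(1)] by auto
  moreover have "u x = 0" if "x \<in> F" for x using abs[of x] that by simp
  ultimately show thesis
    using that[of "Blinfun u"] bl u(3) by (simp add: bounded_linear_Blinfun_apply)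
qed

subsection \<open>Spans of finite sets\<close>

text \<open>A convergent sequence is bounded, so it stays in one of the compact pieces, which
  contains its limit.\<close>

lemma closed_if_compact_Int_cball:
  fixes S :: "'a::real_normed_vector set"
  assumes "\<And>r. compact (cball 0 r \<inter> S)"
  shows "closed S"
  unfolding closed_sequential_limits
proof (intro allI impI, elim conjE)
  fix x l assume x: "\<forall>n. x n \<in> S" "x \<longlonglongrightarrow> l"
  then have "bounded (range x)" by (simp add: convergent_imp_bounded)
  then obtain r where "\<And>n. norm (x n) \<le> r" by (auto simp: bounded_iff)
  then have "\<forall>n. x n \<in> cball 0 r \<inter> S" using x by simp
  moreover have "closed (cball 0 r \<inter> S)" using assms by (rule compact_imp_closed)
  ultimately show "l \<in> S" using x(2) unfolding closed_sequential_limits by blast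
qed

text \<open>Induction on B. For a new b outside the span of B, the distance d from b to this closed
  span is positive and bounds the b-coordinate of a vector of norm at most r by r/d. The new piece
  is thus cut out of a continuous image of a compact product.\<close>

lemma compact_cball_Int_span:
  fixes B :: "'a::real_normed_vector set"
  assumes "finite B"
  shows "compact (cball 0 r \<inter> span B)"
  using assms
proof (induction B arbitrary: r)
  case empty
  have "cball 0 r \<inter> span {} \<subseteq> {0::'a}" by auto
  then show ?case by (meson finite.emptyI finite_imp_compact finite_insert finite_subset)
next
  case (insert b B)
  have cl: "closed (span B)" using insert.IH by (rule closed_if_compact_Int_cball)
  show ?case
  proof (cases "b \<in> span B")
    case True
    then show ?thesis using insert.IH by (simp add: span_redundant)
  next
    case False
    define d where "d = infdist b (span B)"
    have d: "0 < d"
      using in_closed_iff_infdist_zero[OF cl, of b] False span_zero[of B] infdist_nonneg[of b "span B"]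
      by (auto simp: d_def less_le)
    have coord: "\<bar>c\<bar> * d \<le> norm (c *\<^sub>R b + y)" if y: "y \<in> span B" for c y
    proof (cases "c = 0")
      case False
      have "d \<le> dist b (- (inverse c *\<^sub>R y))"
        unfolding d_def using y by (intro infdist_le) (simp add: span_neg span_scale)
      then have "\<bar>c\<bar> * d \<le> norm c * norm (b + inverse c *\<^sub>R y)"
        by (simp add: dist_norm mult_left_mono)
      also have "\<dots> = norm (c *\<^sub>R b + y)"
        using False by (simp add: scaleR_add_right flip: norm_scaleR)
      finally show ?thesis .
    qed simp
    \<comment> \<open>R bounds the norm of x - c b when x has norm at most r and c is at most r/d in
      absolute value.\<close>
    define R where "R = r + r / d * norm b"
    define C where "C = (\<lambda>z. fst z *\<^sub>R b + snd z) ` ({- (r/d)..r/d} \<times> (cball 0 R \<inter> span B))"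
    have "compact C"
      unfolding C_def
      by (intro compact_continuous_image continuous_intros compact_Times compact_Icc insert.IH)
    moreover have "cball 0 r \<inter> span (insert b B) = C \<inter> cball 0 r"
    proof (intro equalityI subsetI)
      fix x assume x: "x \<in> cball 0 r \<inter> span (insert b B)"
      then obtain c where c: "x - c *\<^sub>R b \<in> span B" by (auto simp: span_breakdown_eq)
      have "\<bar>c\<bar> * d \<le> r" using coord[OF c, of c] x by simp
      then have cr: "\<bar>c\<bar> \<le> r / d" using d by (simp add: le_divide_eq)
      have "norm (x - c *\<^sub>R b) \<le> norm x + norm (c *\<^sub>R b)" by (rule norm_triangle_ineq4)
      also have "\<dots> \<le> R"
        unfolding R_def norm_scaleR using x cr
        by (intro add_mono mult_right_mono) auto
      finally have "(c, x - c *\<^sub>R b) \<in> {- (r/d)..r/d} \<times> (cball 0 R \<inter> span B)"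
        using c cr by auto
      then show "x \<in> C \<inter> cball 0 r" unfolding C_def using x by force
    next
      fix x assume "x \<in> C \<inter> cball 0 r"
      then show "x \<in> cball 0 r \<inter> span (insert b B)"
        using span_mono[OF subset_insertI[of B b]]
        by (auto simp: C_def intro!: span_add span_scale intro: span_base)
    qed
    ultimately show ?thesis by (simp add: compact_Int_closed)
  qed
qed

lemma closed_span_finite:
  fixes B :: "'a::real_normed_vector set"
  assumes "finite B"
  shows "closed (span B)"
  using compact_cball_Int_span[OF assms] by (rule closed_if_compact_Int_cball)

subsection \<open>Positively homogeneous functions on the dual\<close>

lemma vector_sublattice_hull: "vector_sublattice (vector_sublattice hull S)"
  by (rule hull_in) (auto simp: vector_sublattice_def)

lemma delta_in_hull: "delta x \<in> vector_sublattice hull (range delta)"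
  by (simp add: hull_inc)

lemma vector_sublatticeD:
  assumes "vector_sublattice L"
  shows "(\<lambda>_. 0) \<in> L"
    and "f \<in> L \<Longrightarrow> g \<in> L \<Longrightarrow> (\<lambda>b. f b + g b) \<in> L"
    and "f \<in> L \<Longrightarrow> (\<lambda>b. c * f b) \<in> L"
    and "f \<in> L \<Longrightarrow> g \<in> L \<Longrightarrow> (\<lambda>b. max (f b) (g b)) \<in> L"
    and "f \<in> L \<Longrightarrow> g \<in> L \<Longrightarrow> (\<lambda>b. min (f b) (g b)) \<in> L"
  using assms by (auto simp: vector_sublattice_def)

lemma vector_sublattice_diff:
  assumes "vector_sublattice L" "f \<in> L" "g \<in> L"
  shows "(\<lambda>b. f b - g b) \<in> L"
  using vector_sublatticeD(2)[OF assms(1,2) vector_sublatticeD(3)[OF assms(1,3), of "-1"]] by simp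

lemma vector_sublattice_abs:
  assumes "vector_sublattice L" "f \<in> L"
  shows "(\<lambda>b. \<bar>f b\<bar>) \<in> L"
proof -
  have "(\<lambda>b. \<bar>f b\<bar>) = (\<lambda>b. max (f b) (- 1 * f b))" by auto
  then show ?thesis
    using vector_sublatticeD(4)[OF assms vector_sublatticeD(3)[OF assms, of "-1"]] by simp
qed

lemma vector_sublattice_Max:
  assumes L: "vector_sublattice L" and "finite K" "K \<noteq> {}" "\<And>k. k \<in> K \<Longrightarrow> f k \<in> L"
  shows "(\<lambda>b. Max ((\<lambda>k. f k b) ` K)) \<in> L"
  using assms(2-4)
proof (induction K rule: finite_ne_induct)
  case (insert k K)
  then have "(\<lambda>b. Max ((\<lambda>k. f k b) ` insert k K)) = (\<lambda>b. max (f k b) (Max ((\<lambda>k. f k b) ` K)))"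
    by simp
  then show ?case using vector_sublatticeD(4)[OF L] insert by simp
qed simp

lemma vector_sublattice_homog_weak_star:
  "vector_sublattice (homog_weak_star :: (('a::real_normed_vector \<Rightarrow>\<^sub>L real) \<Rightarrow> real) set)"
  unfolding vector_sublattice_def homog_weak_star_def weak_star_cont_on_bounded_def
  by (auto simp: pos_homogeneous_def distrib_left max_mult_distrib_left min_mult_distrib_left
      intro!: continuous_intros)

lemma delta_homog_weak_star: "delta x \<in> homog_weak_star"
  unfolding homog_weak_star_def weak_star_cont_on_bounded_def pos_homogeneous_def delta_def
  using strong_operator_topology_continuous_evaluation[of x]
  by (auto simp: scaleR_blinfun.rep_eq intro: continuous_map_from_subtopology)

lemma hull_subset_homog_weak_star:
  "vector_sublattice hull (range delta) \<subseteq> homog_weak_star"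
  using delta_homog_weak_star vector_sublattice_homog_weak_star by (intro hull_minimal) auto

lemma pos_homogeneous_0:
  assumes "pos_homogeneous f"
  shows "f 0 = 0"
proof -
  have "f (0 *\<^sub>R 0) = 0 * f 0" using assms unfolding pos_homogeneous_def by blast
  then show ?thesis by simp
qed

text \<open>The norm topology is finer than the weak-star topology, so f is norm continuous on the
  unit ball. Continuity at 0 bounds f near 0, and homogeneity turns this into a linear bound
  everywhere.\<close>

lemma homog_weak_star_bounded:
  fixes f :: "('a::real_normed_vector \<Rightarrow>\<^sub>L real) \<Rightarrow> real"
  assumes "f \<in> homog_weak_star"
  obtains C where "0 \<le> C" "\<And>xs. \<bar>f xs\<bar> \<le> C * norm xs"
proof -
  have hom: "pos_homogeneous f" using assms by (simp add: homog_weak_star_def)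
  have "continuous_map (subtopology weak_star_topology (cball 0 1)) euclideanreal f"
    using assms by (auto simp: homog_weak_star_def weak_star_cont_on_bounded_def)
  moreover have "continuous_map (top_of_set (cball 0 1))
      (subtopology weak_star_topology (cball 0 1)) (\<lambda>f :: 'a \<Rightarrow>\<^sub>L real. f)"
    using strong_operator_topology_weaker_than_euclidean
    by (intro continuous_map_into_subtopology continuous_map_from_subtopology) auto
  ultimately have "continuous_map (top_of_set (cball 0 1)) euclideanreal (f \<circ> (\<lambda>f. f))"
    by (rule continuous_map_compose[rotated])
  then have "continuous_on (cball 0 1) f" by (simp add: o_def)
  then obtain r where r: "0 < r" "\<And>xs. norm xs \<le> 1 \<Longrightarrow> norm xs < r \<Longrightarrow> \<bar>f xs\<bar> < 1"
    unfolding continuous_on_iff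
    using pos_homogeneous_0[OF hom] by (force dest: bspec[of _ _ 0] spec[of _ 1])
  \<comment> \<open>Vectors of norm s must lie both in the unit ball and strictly inside the radius
    r.\<close>
  define s where "s = min 1 (r/2)"
  have s: "0 < s" "s \<le> 1" "s < r" using r(1) by (auto simp: s_def min_def)
  have "\<bar>f xs\<bar> \<le> inverse s * norm xs" for xs
  proof (cases "xs = 0")
    case False
    define t where "t = s / norm xs"
    have t: "0 < t" using s False by (simp add: t_def)
    have "norm (t *\<^sub>R xs) = s" using False s by (simp add: t_def)
    then have "\<bar>f (t *\<^sub>R xs)\<bar> < 1" using s by (intro r(2)) auto
    moreover have "f (t *\<^sub>R xs) = t * f xs" using hom t by (simp add: pos_homogeneous_def)
    ultimately have "t * \<bar>f xs\<bar> < 1" using t by (simp add: abs_mult)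
    then show ?thesis using s False by (simp add: t_def field_simps)
  qed (simp add: pos_homogeneous_0[OF hom])
  with that[of "inverse s"] s show thesis by simp
qed

section \<open>The norm as the best constant in a linear bound\<close>

lemma dual_sup_norm_le:
  assumes "\<And>xs. \<bar>f xs\<bar> \<le> C * norm xs" "0 \<le> C"
  shows "dual_sup_norm f \<le> C"
  unfolding dual_sup_norm_def
proof (rule cSUP_least)
  show "{xs. norm xs \<le> 1} \<noteq> {}" by (auto intro: exI[of _ 0])
  fix xs :: "'a \<Rightarrow>\<^sub>L real" assume "xs \<in> {xs. norm xs \<le> 1}"
  then have "C * norm xs \<le> C * 1" using assms(2) by (intro mult_left_mono) auto
  then show "\<bar>f xs\<bar> \<le> C" using assms(1)[of xs] by simp
qed

text \<open>By \<open>homog_weak_star_bounded\<close> the supremum is over a bounded set, so it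
  dominates the value at the normalised functional; homogeneity rescales.\<close>

lemma abs_le_dual_sup_norm:
  assumes f: "f \<in> homog_weak_star"
  shows "\<bar>f xs\<bar> \<le> dual_sup_norm f * norm xs"
proof (cases "xs = 0")
  case True
  then show ?thesis using f pos_homogeneous_0 by (auto simp: homog_weak_star_def)
next
  case False
  obtain C where C: "0 \<le> C" "\<And>xs. \<bar>f xs\<bar> \<le> C * norm xs" using homog_weak_star_bounded[OF f] by blast
  have "bdd_above ((\<lambda>xs. \<bar>f xs\<bar>) ` {xs. norm xs \<le> 1})"
  proof (rule bdd_aboveI2)
    fix xs :: "'a \<Rightarrow>\<^sub>L real" assume "xs \<in> {xs. norm xs \<le> 1}"
    then have "C * norm xs \<le> C * 1" using C(1) by (intro mult_left_mono) auto
    then show "\<bar>f xs\<bar> \<le> C" using C(2)[of xs] by simp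
  qed
  then have "\<bar>f (inverse (norm xs) *\<^sub>R xs)\<bar> \<le> dual_sup_norm f"
    unfolding dual_sup_norm_def by (rule cSUP_upper[rotated]) (use False in simp)
  moreover have "f (inverse (norm xs) *\<^sub>R xs) = inverse (norm xs) * f xs"
    using f by (simp add: homog_weak_star_def pos_homogeneous_def)
  ultimately have "inverse (norm xs) * \<bar>f xs\<bar> \<le> dual_sup_norm f" by (simp add: abs_mult)
  then show ?thesis using False by (simp add: field_simps)
qed

lemma dual_sup_norm_nonneg:
  assumes "f \<in> homog_weak_star"
  shows "0 \<le> dual_sup_norm f"
proof (cases "\<exists>xs :: 'a \<Rightarrow>\<^sub>L real. xs \<noteq> 0")
  case True
  then obtain xs :: "'a \<Rightarrow>\<^sub>L real" where "xs \<noteq> 0" by blast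
  then show ?thesis
    using abs_le_dual_sup_norm[OF assms, of xs] abs_ge_zero[of "f xs"]
    by (metis order_trans zero_le_mult_iff norm_le_zero_iff)
next
  case False
  then have "{xs :: 'a \<Rightarrow>\<^sub>L real. norm xs \<le> 1} = {0}" by auto
  then show ?thesis by (simp add: dual_sup_norm_def)
qed

section \<open>Membership in the closure by uniform approximation\<close>

lemma FBL_infty_subset: "FBL_infty \<subseteq> homog_weak_star"
  by (auto simp: FBL_infty_def)

text \<open>An error of at most \<open>e * norm xs\<close> is uniformly small on bounded sets, so f
  inherits weak-star continuity there as a uniform limit. The same estimate bounds the norm of the
  difference by e.\<close>

lemma FBL_inftyI:
  fixes f :: "('a::banach \<Rightarrow>\<^sub>L real) \<Rightarrow> real"
  assumes hom: "pos_homogeneous f"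
    and approx: "\<And>e. 0 < e \<Longrightarrow>
      \<exists>g \<in> vector_sublattice hull (range delta). \<forall>xs. \<bar>f xs - g xs\<bar> \<le> e * norm xs"
  shows "f \<in> FBL_infty"
proof -
  have "continuous_map (subtopology weak_star_topology B) euclideanreal f" if B: "bounded B" for B
  proof -
    obtain R where R: "0 < R" "\<And>xs. xs \<in> B \<Longrightarrow> norm xs \<le> R"
      using B unfolding bounded_pos by blast
    have "\<exists>g. continuous_map (subtopology weak_star_topology B) euclideanreal g
        \<and> (\<forall>xs\<in>B. \<bar>g xs - f xs\<bar> \<le> inverse (Suc n))" for n
    proof -
      \<comment> \<open>Dividing by the radius R makes the error on all of B at most 1/(n +
        1).\<close>
      define e where "e = inverse (Suc n) / R"
      have "0 < e" using R by (simp add: e_def)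
      then obtain g where g: "g \<in> vector_sublattice hull (range delta)"
          "\<And>xs. \<bar>f xs - g xs\<bar> \<le> e * norm xs" using approx by blast
      have "\<bar>g xs - f xs\<bar> \<le> inverse (Suc n)" if "xs \<in> B" for xs
      proof -
        have "e * norm xs \<le> e * R" using R(2)[OF that] \<open>0 < e\<close> by (intro mult_left_mono) auto
        also have "\<dots> = inverse (Suc n)" using R by (simp add: e_def)
        finally show ?thesis using g(2)[of xs] by simp
      qed
      moreover have "continuous_map (subtopology weak_star_topology B) euclideanreal g"
        using g(1) hull_subset_homog_weak_star B
        by (auto simp: homog_weak_star_def weak_star_cont_on_bounded_def)
      ultimately show ?thesis by blast
    qed
    then obtain g where g: "\<And>n. continuous_map (subtopology weak_star_topology B) euclideanreal (g n)"
        "\<And>n xs. xs \<in> B \<Longrightarrow> \<bar>g n xs - f xs\<bar> \<le> inverse (Suc n)" by metis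
    have "continuous_map (subtopology weak_star_topology B) Met_TC.mtopology f"
    proof (rule Met_TC.continuous_map_uniform_limit[where F = sequentially and f = g])
      fix e :: real assume "0 < e"
      have "\<forall>\<^sub>F n in sequentially. inverse (real (Suc n)) < e"
        using LIMSEQ_inverse_real_of_nat \<open>0 < e\<close> by (rule order_tendstoD)
      then show "\<forall>\<^sub>F n in sequentially. \<forall>xs\<in>topspace (subtopology weak_star_topology B).
          f xs \<in> UNIV \<and> dist (g n xs) (f xs) < e"
        by (rule eventually_mono) (auto simp: dist_real_def strong_operator_topology_topspace
            intro: le_less_trans[OF g(2)])
    qed (use g in simp_all)
    then show ?thesis by simp
  qed
  then have "f \<in> homog_weak_star"
    using hom by (simp add: homog_weak_star_def weak_star_cont_on_bounded_def)
  moreover have "\<exists>g \<in> vector_sublattice hull (range delta). dual_sup_norm (\<lambda>xs. f xs - g xs) < e"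
    if e: "0 < e" for e
  proof -
    obtain g where g: "g \<in> vector_sublattice hull (range delta)"
        "\<And>xs. \<bar>f xs - g xs\<bar> \<le> e/2 * norm xs" using approx[of "e/2"] e by auto
    have "dual_sup_norm (\<lambda>xs. f xs - g xs) \<le> e/2"
      using g(2) e by (intro dual_sup_norm_le) auto
    then have "dual_sup_norm (\<lambda>xs. f xs - g xs) < e" using e by simp
    with g(1) show ?thesis by blast
  qed
  ultimately show ?thesis by (simp add: FBL_infty_def)
qed

lemma hull_subset_FBL_infty: "vector_sublattice hull (range delta) \<subseteq> FBL_infty"
proof
  fix f :: "('a \<Rightarrow>\<^sub>L real) \<Rightarrow> real" assume f: "f \<in> vector_sublattice hull (range delta)"
  show "f \<in> FBL_infty"
  proof (rule FBL_inftyI)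
    show "pos_homogeneous f"
      using f hull_subset_homog_weak_star by (auto simp: homog_weak_star_def)
    show "\<exists>g \<in> vector_sublattice hull (range delta). \<forall>xs. \<bar>f xs - g xs\<bar> \<le> e * norm xs"
      if "0 < e" for e
      using f that by (intro bexI[of _ f]) auto
  qed
qed

subsection \<open>Finite dimension\<close>

text \<open>The unit ball is compact, so it has a finite d-net K. The maximum of the evaluations at
  K lies between \<open>norm xs - d * norm xs\<close> and \<open>norm xs\<close>.\<close>

lemma dual_norm_in_FBL_infty:
  assumes B: "finite B" "span B = (UNIV :: 'a::banach set)" and "0 \<le> M"
  shows "(\<lambda>xs :: 'a \<Rightarrow>\<^sub>L real. M * norm xs) \<in> FBL_infty"
proof (rule FBL_inftyI)
  show "pos_homogeneous (\<lambda>xs :: 'a \<Rightarrow>\<^sub>L real. M * norm xs)" by (simp add: pos_homogeneous_def)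
  fix e :: real assume e: "0 < e"
  \<comment> \<open>The denominator M + 1 gives M d \<le> e and stays positive for M = 0.\<close>
  define d where "d = e / (M + 1)"
  have d: "0 < d" "M * d \<le> e" using e assms(3) by (auto simp: d_def field_simps)
  have "compact (cball (0::'a) 1)" using compact_cball_Int_span[OF B(1), of 1] B(2) by simp
  moreover have "cball 0 1 \<subseteq> (\<Union>k\<in>cball (0::'a) 1. ball k d)" using d(1) by force
  ultimately obtain K where K: "K \<subseteq> cball (0::'a) 1" "finite K" "cball 0 1 \<subseteq> (\<Union>k\<in>K. ball k d)"
    using compactE_image[of "cball (0::'a) 1" "cball 0 1" "\<lambda>k. ball k d"] by (metis open_ball)
  then have ne: "K \<noteq> {}" by fastforce
  define g where "g = (\<lambda>xs :: 'a \<Rightarrow>\<^sub>L real. Max ((\<lambda>k. delta k xs) ` K))"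
  have "g \<in> vector_sublattice hull (range delta)"
    unfolding g_def using K(2) ne by (intro vector_sublattice_Max vector_sublattice_hull delta_in_hull)
  then have Mg: "(\<lambda>xs. M * g xs) \<in> vector_sublattice hull (range delta)"
    by (rule vector_sublatticeD(3)[OF vector_sublattice_hull])
  have upper: "g xs \<le> norm xs" for xs
    unfolding g_def
  proof (rule Max.boundedI)
    fix a assume "a \<in> (\<lambda>k. delta k xs) ` K"
    then obtain k where k: "k \<in> K" "a = blinfun_apply xs k" by (auto simp: delta_def)
    have "\<bar>blinfun_apply xs k\<bar> \<le> norm xs * norm k" using norm_blinfun[of xs k] by simp
    also have "\<dots> \<le> norm xs * 1" using k K by (intro mult_left_mono) auto
    finally show "a \<le> norm xs" using k by simp
  qed (use K ne in auto)
  have ball: "blinfun_apply xs x \<le> g xs + d * norm xs" if "norm x \<le> 1" for xs x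
  proof -
    have "x \<in> (\<Union>k\<in>K. ball k d)" using that by (intro subsetD[OF K(3)]) simp
    then obtain k where k: "k \<in> K" "dist k x < d" by auto
    have "blinfun_apply xs x = blinfun_apply xs k + blinfun_apply xs (x - k)"
      by (simp add: blinfun.diff_right)
    also have "blinfun_apply xs k \<le> g xs"
      unfolding g_def using K(2) k(1) by (intro Max_ge) (auto simp: delta_def)
    also have "blinfun_apply xs (x - k) \<le> norm xs * norm (x - k)"
      using norm_blinfun[of xs "x - k"] by simp
    also have "\<dots> \<le> norm xs * d"
      using k(2) by (intro mult_left_mono) (auto simp: dist_norm norm_minus_commute)
    finally show ?thesis by (simp add: mult.commute)
  qed
  have lower: "norm xs \<le> g xs + d * norm xs" for xs
  proof (rule norm_blinfun_bound)
    show "0 \<le> g xs + d * norm xs" using ball[of 0 xs] by simp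
    fix x
    show "norm (blinfun_apply xs x) \<le> (g xs + d * norm xs) * norm x"
    proof (cases "x = 0")
      case False
      define y where "y = inverse (norm x) *\<^sub>R x"
      have x: "x = norm x *\<^sub>R y" and y: "norm y = 1" using False by (auto simp: y_def)
      \<comment> \<open>The maximum defining g is taken without absolute values; the ball is
        symmetric, so the estimate for both y and -y bounds the absolute value.\<close>
      have "\<bar>blinfun_apply xs y\<bar> \<le> g xs + d * norm xs"
        using ball[of y xs] ball[of "- y" xs] y by (simp add: blinfun.minus_right)
      then have "norm x * \<bar>blinfun_apply xs y\<bar> \<le> norm x * (g xs + d * norm xs)"
        by (intro mult_left_mono) auto
      moreover have "blinfun_apply xs x = norm x * blinfun_apply xs y"
        by (subst x) (simp add: blinfun.scaleR_right)
      ultimately show ?thesis by (simp add: abs_mult mult.commute)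
    qed simp
  qed
  have "\<bar>M * norm xs - M * g xs\<bar> \<le> e * norm xs" for xs
  proof -
    have "\<bar>M * norm xs - M * g xs\<bar> = M * (norm xs - g xs)"
      using upper[of xs] assms(3) by (simp add: abs_mult flip: right_diff_distrib)
    also have "\<dots> \<le> M * (d * norm xs)"
      using lower[of xs] assms(3) by (intro mult_left_mono) auto
    also have "\<dots> \<le> e * norm xs" using mult_right_mono[OF d(2) norm_ge_zero[of xs]] by (simp add: mult.assoc)
    finally show ?thesis .
  qed
  with Mg show "\<exists>g \<in> vector_sublattice hull (range delta).
      \<forall>xs :: 'a \<Rightarrow>\<^sub>L real. \<bar>M * norm xs - g xs\<bar> \<le> e * norm xs"
    by (intro bexI[of _ "\<lambda>xs. M * g xs"]) auto
qed

lemma lambda_Fatou_finite_dimensional: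
  assumes B: "finite B" "span B = (UNIV :: 'a::banach set)" and "1 \<le> lam"
  shows "lambda_Fatou lam (FBL_infty :: (('a \<Rightarrow>\<^sub>L real) \<Rightarrow> real) set) dual_sup_norm"
  unfolding lambda_Fatou_def
proof (intro allI impI, elim conjE)
  fix S :: "(('a \<Rightarrow>\<^sub>L real) \<Rightarrow> real) set" and z0
  assume S: "S \<subseteq> {z \<in> FBL_infty. (\<lambda>_. 0) \<le> z}" "upward_directed S" and lub: "isLub FBL_infty S z0"
  have hom: "z \<in> homog_weak_star" if "z \<in> S" for z using S(1) that FBL_infty_subset by auto
  have z0: "z0 \<in> FBL_infty" "\<And>z. z \<in> S \<Longrightarrow> z \<le> z0"
    using lub by (auto simp: isLub_def leastP_def isUb_def setle_def)
  then have z0h: "z0 \<in> homog_weak_star" using FBL_infty_subset by auto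
  obtain s where s: "s \<in> S" using S(2) by (auto simp: upward_directed_def)
  then have pos: "0 \<le> z0 xs" for xs
    using S(1) z0(2)[OF s] by (force simp: le_fun_def intro: order_trans)
  \<comment> \<open>Needed for the supremum of the norms to be a genuine one: all members lie
    between 0 and z0.\<close>
  have "bdd_above (dual_sup_norm ` S)"
  proof (rule bdd_aboveI2)
    fix z assume z: "z \<in> S"
    have "\<bar>z xs\<bar> \<le> dual_sup_norm z0 * norm xs" for xs
    proof -
      have "0 \<le> z xs" "z xs \<le> z0 xs" using S(1) z z0(2)[OF z] by (auto simp: le_fun_def)
      then show ?thesis using abs_le_dual_sup_norm[OF z0h, of xs] by simp
    qed
    then show "dual_sup_norm z \<le> dual_sup_norm z0"
      using dual_sup_norm_nonneg[OF z0h] by (rule dual_sup_norm_le)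
  qed
  then have upper: "dual_sup_norm z \<le> (SUP z\<in>S. dual_sup_norm z)" if "z \<in> S" for z
    using that by (intro cSUP_upper)
  define M where "M = (SUP z\<in>S. dual_sup_norm z)"
  have M: "0 \<le> M" using upper[OF s] dual_sup_norm_nonneg[OF hom[OF s]] by (simp add: M_def)
  have "z xs \<le> M * norm xs" if "z \<in> S" for z xs
  proof -
    have "z xs \<le> dual_sup_norm z * norm xs" using abs_le_dual_sup_norm[OF hom[OF that], of xs] by simp
    also have "\<dots> \<le> M * norm xs" unfolding M_def using upper[OF that] by (intro mult_right_mono) auto
    finally show ?thesis .
  qed
  then have "isUb FBL_infty S (\<lambda>xs. M * norm xs)"
    using dual_norm_in_FBL_infty[OF B M] by (auto simp: isUb_def setle_def le_fun_def)
  then have "z0 xs \<le> M * norm xs" for xs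
    using lub by (auto simp: isLub_def leastP_def setge_def le_fun_def)
  then have "dual_sup_norm z0 \<le> M" using pos M by (intro dual_sup_norm_le) auto
  also have "M \<le> lam * M" using M assms(3) by (simp add: mult_le_cancel_right1)
  finally show "dual_sup_norm z0 \<le> lam * (SUP z\<in>S. dual_sup_norm z)" by (simp add: M_def)
qed

subsection \<open>Infinite dimension\<close>

text \<open>The topology is pulled back from the product topology, and a basic open set of a product
  restricts only finitely many coordinates. These coordinates form F.\<close>

lemma weak_star_open_contains_affine:
  fixes xs :: "'a::real_normed_vector \<Rightarrow>\<^sub>L real"
  assumes "openin weak_star_topology U" "xs \<in> U"
  obtains F where "finite F"
    "\<And>ys. (\<And>x. x \<in> F \<Longrightarrow> blinfun_apply ys x = blinfun_apply xs x) \<Longrightarrow> ys \<in> U"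
proof -
  obtain V where V: "open V" "U = blinfun_apply -` V"
    using assms(1) by (auto simp: strong_operator_topology_def openin_pullback_topology)
  then have "openin (product_topology (\<lambda>i. euclidean) UNIV) V" by (simp add: open_fun_def)
  moreover have "blinfun_apply xs \<in> V" using assms V by simp
  ultimately have "\<exists>X. blinfun_apply xs \<in> (\<Pi>\<^sub>E i\<in>UNIV. X i) \<and> (\<forall>i. openin euclidean (X i))
      \<and> finite {i. X i \<noteq> topspace euclidean} \<and> (\<Pi>\<^sub>E i\<in>UNIV. X i) \<subseteq> V"
    by (rule product_topology_open_contains_basis)
  then obtain X where X: "blinfun_apply xs \<in> (\<Pi>\<^sub>E i\<in>UNIV. X i)" "finite {i. X i \<noteq> UNIV}"
      "(\<Pi>\<^sub>E i\<in>UNIV. X i) \<subseteq> V" by auto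
  show thesis
  proof (rule that[OF X(2)])
    fix ys assume eq: "\<And>x. x \<in> {i. X i \<noteq> UNIV} \<Longrightarrow> blinfun_apply ys x = blinfun_apply xs x"
    have "blinfun_apply ys x \<in> X x" for x
    proof (cases "X x = UNIV")
      case False
      then show ?thesis using eq[of x] X(1) by (auto simp: PiE_iff)
    qed simp
    then show "ys \<in> U" using X(3) V(2) by (auto simp: PiE_iff)
  qed
qed

text \<open>After shrinking xs, positivity of g within the unit ball depends on a weak-star
  neighbourhood, hence is kept when the values on a finite set F are kept. In infinite dimension
  some nonzero u vanishes on F and x, and moving along u reaches the unit sphere.\<close>

lemma homog_weak_star_pos_at_unit:
  fixes g :: "('a::real_normed_vector \<Rightarrow>\<^sub>L real) \<Rightarrow> real"
  assumes inf: "infinite_dimensional TYPE('a)" and g: "g \<in> homog_weak_star" "0 < g xs" and e: "0 < e"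
  obtains ys where "norm ys = 1" "0 < g ys" "\<bar>blinfun_apply ys x\<bar> < e"
proof -
  have hom: "g (t *\<^sub>R v) = t * g v" if "0 \<le> t" for t v
    using g(1) that by (simp add: homog_weak_star_def pos_homogeneous_def)
  obtain t where t: "0 < t" "t * norm xs \<le> 1" "t * \<bar>blinfun_apply xs x\<bar> < e"
  proof
    \<comment> \<open>Small enough to put the scaled functional in the unit ball with value at x
      below e; the summand 1 keeps the denominator positive and makes the second bound
      strict.\<close>
    define t where "t = min 1 e / (norm xs + \<bar>blinfun_apply xs x\<bar> + 1)"
    have den: "0 < norm xs + \<bar>blinfun_apply xs x\<bar> + 1"
      by (intro add_nonneg_pos) auto
    show t: "0 < t" using e den by (simp add: t_def)
    have eq: "t * (norm xs + \<bar>blinfun_apply xs x\<bar> + 1) = min 1 e" using den by (simp add: t_def)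
    have "t * norm xs \<le> t * (norm xs + \<bar>blinfun_apply xs x\<bar> + 1)"
      using t by (intro mult_left_mono) auto
    then show "t * norm xs \<le> 1" using eq by simp
    have "t * \<bar>blinfun_apply xs x\<bar> < t * (norm xs + \<bar>blinfun_apply xs x\<bar> + 1)"
      using t by (intro mult_strict_left_mono) (auto intro: add_nonneg_pos)
    then show "t * \<bar>blinfun_apply xs x\<bar> < e" using eq by simp
  qed
  define zs where "zs = t *\<^sub>R xs"
  have zs: "norm zs \<le> 1" "0 < g zs" "\<bar>blinfun_apply zs x\<bar> < e"
    using t g(2) by (auto simp: zs_def hom scaleR_blinfun.rep_eq abs_mult)
  have "continuous_map (subtopology weak_star_topology (cball 0 1)) euclideanreal g"
    using g(1) by (auto simp: homog_weak_star_def weak_star_cont_on_bounded_def)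
  then have "openin (subtopology weak_star_topology (cball 0 1))
      {v \<in> topspace (subtopology weak_star_topology (cball 0 1)). g v \<in> {0<..}}"
    by (rule openin_continuous_map_preimage) simp
  then obtain U where U: "openin weak_star_topology U" "{v \<in> cball 0 1. 0 < g v} = U \<inter> cball 0 1"
    by (auto simp: openin_subtopology strong_operator_topology_topspace)
  have "zs \<in> U" using U(2) zs by auto
  then obtain F where F: "finite F"
      "\<And>ys. (\<And>x. x \<in> F \<Longrightarrow> blinfun_apply ys x = blinfun_apply zs x) \<Longrightarrow> ys \<in> U"
    using weak_star_open_contains_affine[OF U(1)] by blast
  \<comment> \<open>Including x in the finite set also freezes the value at x while moving along
    u.\<close>
  have "span (insert x F) \<noteq> UNIV" using inf F(1) by (auto simp: infinite_dimensional_def)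
  then obtain v where "v \<notin> span (insert x F)" by auto
  then obtain u :: "'a \<Rightarrow>\<^sub>L real" where u: "\<And>y. y \<in> span (insert x F) \<Longrightarrow> blinfun_apply u y = 0"
      "blinfun_apply u v \<noteq> 0"
    using separating_functional[OF subspace_span closed_span_finite] F(1) by (metis finite_insert)
  then have "u \<noteq> 0" by auto
  \<comment> \<open>At the right endpoint a vector of norm 2 is added to one of norm at most 1, so
    the norm there is at least 1.\<close>
  have "\<exists>s\<ge>0. s \<le> 2 / norm u \<and> norm (zs + s *\<^sub>R u) = 1"
  proof (rule IVT')
    show "norm (zs + 0 *\<^sub>R u) \<le> 1" using zs by simp
    have "norm ((2 / norm u) *\<^sub>R u) = 2" using \<open>u \<noteq> 0\<close> by simp
    then show "1 \<le> norm (zs + (2 / norm u) *\<^sub>R u)"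
      using norm_triangle_ineq4[of "zs + (2 / norm u) *\<^sub>R u" zs] zs(1) by simp
  qed (auto intro!: continuous_intros)
  then obtain s where s: "norm (zs + s *\<^sub>R u) = 1" by blast
  have eq: "blinfun_apply (zs + s *\<^sub>R u) y = blinfun_apply zs y" if "y \<in> insert x F" for y
    using u(1)[OF span_base[OF that]] by (simp add: plus_blinfun.rep_eq scaleR_blinfun.rep_eq)
  have "zs + s *\<^sub>R u \<in> U" using eq by (intro F(2)) auto
  then have "zs + s *\<^sub>R u \<in> U \<inter> cball 0 1" using s by simp
  then have "0 < g (zs + s *\<^sub>R u)" unfolding U(2)[symmetric] by blast
  then show thesis using that[OF s] eq[of x] zs(3) by simp
qed

section \<open>The directed family of small minorants\<close>

lemma exists_norm_gt_half:
  fixes ys :: "'a::real_normed_vector \<Rightarrow>\<^sub>L real"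
  assumes "norm ys = 1"
  obtains v where "v \<noteq> 0" "norm v / 2 < \<bar>blinfun_apply ys v\<bar>"
proof -
  have "\<exists>v. norm v / 2 < \<bar>blinfun_apply ys v\<bar>"
  proof (rule ccontr)
    assume "\<not> ?thesis"
    then have "norm ys \<le> 1/2" by (intro norm_blinfun_bound) (auto simp: not_less)
    with assms show False by simp
  qed
  then show thesis using that by force
qed

text \<open>The pointwise bound by \<open>e * norm xs\<close> expresses norm at most e for these
  nonnegative functions and visibly passes to maxima, which gives directedness.\<close>

definition small_minorants :: "'a::real_normed_vector \<Rightarrow> real \<Rightarrow> (('a \<Rightarrow>\<^sub>L real) \<Rightarrow> real) set"
  where "small_minorants x e = {f \<in> vector_sublattice hull (range delta).
    \<forall>xs. 0 \<le> f xs \<and> f xs \<le> \<bar>delta x xs\<bar> \<and> f xs \<le> e * norm xs}"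

lemma upward_directed_small_minorants:
  assumes "0 \<le> e"
  shows "upward_directed (small_minorants x e)"
  unfolding upward_directed_def
proof (intro conjI ballI)
  have "(\<lambda>_. 0) \<in> small_minorants x e"
    using assms vector_sublatticeD(1)[OF vector_sublattice_hull] by (auto simp: small_minorants_def)
  then show "small_minorants x e \<noteq> {}" by blast
  fix f g assume fg: "f \<in> small_minorants x e" "g \<in> small_minorants x e"
  then have "(\<lambda>b. max (f b) (g b)) \<in> small_minorants x e"
    using vector_sublatticeD(4)[OF vector_sublattice_hull]
    by (auto simp: small_minorants_def le_max_iff_disj)
  then show "\<exists>h\<in>small_minorants x e. f \<le> h \<and> g \<le> h"
    by (rule bexI[rotated]) (simp add: le_fun_def)
qed

text \<open>Not a pointwise supremum: where \<open>\<bar>delta x xs\<bar>\<close> exceeds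
  \<open>e * norm xs\<close>, every member stays strictly below it. The weak-star continuity of an
  upper bound h carries a failure of h to a unit functional that is small at x, where some member
  equals \<open>\<bar>delta x xs\<bar>\<close>.\<close>

lemma isLub_small_minorants:
  fixes x :: "'a::banach"
  assumes inf: "infinite_dimensional TYPE('a)" and e: "0 < e"
  shows "isLub FBL_infty (small_minorants x e) (\<lambda>xs. \<bar>delta x xs\<bar>)"
proof -
  have abs: "(\<lambda>xs. \<bar>delta y xs\<bar>) \<in> vector_sublattice hull (range delta)" for y :: 'a
    using vector_sublattice_hull delta_in_hull by (rule vector_sublattice_abs)
  have "\<bar>delta x xs\<bar> \<le> h xs" if h: "isUb FBL_infty (small_minorants x e) h" for h xs
  proof (rule ccontr)
    assume "\<not> ?thesis"
    then have neg: "0 < \<bar>delta x xs\<bar> - h xs" by simp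
    have "h \<in> homog_weak_star" using h FBL_infty_subset by (auto simp: isUb_def)
    then have "(\<lambda>xs. \<bar>delta x xs\<bar> - h xs) \<in> homog_weak_star"
      using abs[of x] hull_subset_homog_weak_star
      by (intro vector_sublattice_diff[OF vector_sublattice_homog_weak_star]) auto
    then obtain ys where ys: "norm ys = 1" "0 < \<bar>delta x ys\<bar> - h ys" "\<bar>blinfun_apply ys x\<bar> < e / 2"
      using homog_weak_star_pos_at_unit
      [where g = "\<lambda>xs. \<bar>delta x xs\<bar> - h xs", OF inf _ neg, of "e/2" x] e by auto
    obtain v where v: "v \<noteq> 0" "norm v / 2 < \<bar>blinfun_apply ys v\<bar>"
      using exists_norm_gt_half[OF ys(1)] by blast
    \<comment> \<open>The factor \<open>e / norm v\<close> keeps the second term below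
      \<open>e * norm xs\<close> everywhere, while at ys it is still at least e/2, above the value
      of the first term.\<close>
    define f where "f = (\<lambda>xs. min \<bar>delta x xs\<bar> (e / norm v * \<bar>delta v xs\<bar>))"
    have "f \<in> vector_sublattice hull (range delta)"
      unfolding f_def using abs
      by (intro vector_sublatticeD(5)[OF vector_sublattice_hull] vector_sublatticeD(3)[OF vector_sublattice_hull])
    moreover have "e / norm v * \<bar>delta v xs\<bar> \<le> e * norm xs" for xs
      using e v(1) norm_blinfun[of xs v] by (simp add: delta_def field_simps)
    ultimately have "f \<in> small_minorants x e"
      using e by (auto simp: small_minorants_def f_def min_le_iff_disj)
    then have "f ys \<le> h ys" using h by (auto simp: isUb_def setle_def le_fun_def)
    moreover have "e / 2 \<le> e / norm v * \<bar>delta v ys\<bar>"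
      using e v by (simp add: delta_def field_simps)
    then have "f ys = \<bar>delta x ys\<bar>"
      using ys(3) unfolding f_def delta_def by (intro min_absorb1) linarith
    ultimately show False using ys(2) by simp
  qed
  then show ?thesis
    using abs[of x] hull_subset_FBL_infty
    by (auto simp: isLub_def leastP_def isUb_def setle_def setge_def small_minorants_def le_fun_def)
qed

lemma not_lambda_Fatou_infinite_dimensional:
  assumes inf: "infinite_dimensional TYPE('a::banach)" and lam: "0 < lam"
  shows "\<not> lambda_Fatou lam (FBL_infty :: (('a \<Rightarrow>\<^sub>L real) \<Rightarrow> real) set) dual_sup_norm"
proof
  assume F: "lambda_Fatou lam (FBL_infty :: (('a \<Rightarrow>\<^sub>L real) \<Rightarrow> real) set) dual_sup_norm"
  have "span {} \<noteq> (UNIV :: 'a set)" using inf unfolding infinite_dimensional_def by blast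
  then obtain x :: 'a where x: "x \<notin> span {}" by blast
  then obtain u :: "'a \<Rightarrow>\<^sub>L real" where u: "blinfun_apply u x \<noteq> 0"
    using separating_functional[OF subspace_span closed_span_finite[OF finite.emptyI], of x] by metis
  define z0 :: "('a \<Rightarrow>\<^sub>L real) \<Rightarrow> real" where "z0 = (\<lambda>xs. \<bar>delta x xs\<bar>)"
  have z0: "z0 \<in> homog_weak_star"
    unfolding z0_def using vector_sublattice_homog_weak_star delta_homog_weak_star
    by (rule vector_sublattice_abs)
  have "0 < z0 u" using u by (simp add: z0_def delta_def)
  then have "0 < dual_sup_norm z0 * norm u" using abs_le_dual_sup_norm[OF z0, of u] by simp
  then have N: "0 < dual_sup_norm z0" by (simp add: zero_less_mult_iff)
  \<comment> \<open>Chosen so that lam e is half the norm of z0, contradicting the Fatou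
    inequality.\<close>
  define e where "e = dual_sup_norm z0 / (2 * lam)"
  have e: "0 < e" using N lam by (simp add: e_def)
  have "small_minorants x e \<subseteq> {z \<in> FBL_infty. (\<lambda>_. 0) \<le> z}"
    using hull_subset_FBL_infty by (auto simp: small_minorants_def le_fun_def)
  then have "dual_sup_norm z0 \<le> lam * (SUP z\<in>small_minorants x e. dual_sup_norm z)"
    using F upward_directed_small_minorants[of e x] isLub_small_minorants[OF inf e, of x] e
    unfolding lambda_Fatou_def z0_def by auto
  also have "(SUP z\<in>small_minorants x e. dual_sup_norm z) \<le> e"
  proof (rule cSUP_least)
    show "small_minorants x e \<noteq> {}"
      using upward_directed_small_minorants[of e x] e by (simp add: upward_directed_def)
    show "dual_sup_norm z \<le> e" if "z \<in> small_minorants x e" for z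
      using that e by (intro dual_sup_norm_le) (auto simp: small_minorants_def)
  qed
  then have "lam * (SUP z\<in>small_minorants x e. dual_sup_norm z) \<le> lam * e"
    using lam by (intro mult_left_mono) auto
  also have "lam * e = dual_sup_norm z0 / 2" using lam by (simp add: e_def)
  finally show False using N by simp
qed

text \<open>The existential ranges over lam \<ge> 1 because, by
  \<open>not_lambda_Fatou_less_1\<close>, a smaller constant already fails whenever some nonnegative
  element has positive norm, and would not detect the dimension.\<close>

theorem proposition6p5:
  shows "(infinite_dimensional TYPE('a::banach) \<longleftrightarrow>
           (\<forall>lam>0. \<not> lambda_Fatou lam (FBL_infty :: (('a \<Rightarrow>\<^sub>L real) \<Rightarrow> real) set) dual_sup_norm))
       \<and> ((\<forall>lam>0. \<not> lambda_Fatou lam (FBL_infty :: (('a \<Rightarrow>\<^sub>L real) \<Rightarrow> real) set) dual_sup_norm) \<longleftrightarrow>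
           (\<exists>lam\<ge>1. \<not> lambda_Fatou lam (FBL_infty :: (('a \<Rightarrow>\<^sub>L real) \<Rightarrow> real) set) dual_sup_norm))"
    (is "(?inf \<longleftrightarrow> ?all) \<and> (?all \<longleftrightarrow> ?some)")
proof -
  have "?inf \<Longrightarrow> ?all" using not_lambda_Fatou_infinite_dimensional by blast
  moreover have "?all \<Longrightarrow> ?some" by (rule exI[of _ 1]) simp
  moreover have "?some \<Longrightarrow> ?inf"
    using lambda_Fatou_finite_dimensional unfolding infinite_dimensional_def by blast
  ultimately show ?thesis by blast
qed

end
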